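(* Let $(X_1,\ldots,X_d)\in M_n(\mathbb{C})^d$. Then $$\hat{\rho}(X_1,\ldots,X_d)=\Big(\inf_{N\in\mathfrak{N}}\Big\|\sum_{i=1}^d\overline{X_i}\otimes X_i\Big\|_N\Big)^{1/2},$$ where $\mathfrak{N}$ is the set of all consistent matrix norms on $M_{n^2}(\mathbb{C})$.
   Context: $\overline{A}$ is the entrywise complex conjugate, $\otimes$ the Kronecker product, $\rho$ the spectral radius, and the outer spectral radius is $\hat{\rho}(X_1,\ldots,X_d)=\sqrt{\rho(\sum_{i=1}^d\overline{X_i}\otimes X_i)}$. A consistent matrix norm is a norm satisfying $\|AB\|\le\|A\|\,\|B\|$ for all $A,B$. *)

theory Defs
  imports "Jordan_Normal_Form.Spectral_Radius"
begin

definition mat_conjugate :: "complex mat \<Rightarrow> complex mat" where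
  "mat_conjugate A = map_mat cnj A"

text \<open>With zero-based indices, the entry of the Kronecker product at row
  \<open>i * dim_row B + k\<close> and column \<open>j * dim_col B + l\<close> is \<open>A\<^sub>i\<^sub>j B\<^sub>k\<^sub>l\<close>.\<close>

definition kronecker :: "complex mat \<Rightarrow> complex mat \<Rightarrow> complex mat"  (infixl "\<otimes>\<^sub>K" 70) where
  "A \<otimes>\<^sub>K B = mat (dim_row A * dim_row B) (dim_col A * dim_col B)
     (\<lambda>(r, c). A $$ (r div dim_row B, c div dim_col B) * B $$ (r mod dim_row B, c mod dim_col B))"

text \<open>The type of matrices carries no dimension and so has no zero element; the sum is therefore
  taken in the module of square matrices of size \<open>n\<^sup>2\<close>.\<close>

definition conj_kronecker_sum :: "nat \<Rightarrow> nat \<Rightarrow> (nat \<Rightarrow> complex mat) \<Rightarrow> complex mat" where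
  "conj_kronecker_sum n d X =
     finsum (module_mat TYPE(complex) (n\<^sup>2) (n\<^sup>2)) (\<lambda>i. mat_conjugate (X i) \<otimes>\<^sub>K X i) {1..d}"

definition outer_spectral_radius :: "nat \<Rightarrow> nat \<Rightarrow> (nat \<Rightarrow> complex mat) \<Rightarrow> real" where
  "outer_spectral_radius n d X = sqrt (spectral_radius (conj_kronecker_sum n d X))"

text \<open>Only the values of a norm on \<open>carrier_mat m m\<close> matter; elsewhere it is unconstrained.\<close>

definition is_matrix_norm :: "nat \<Rightarrow> (complex mat \<Rightarrow> real) \<Rightarrow> bool" where
  "is_matrix_norm m N \<longleftrightarrow>
     (\<forall>A\<in>carrier_mat m m. 0 \<le> N A) \<and>
     (\<forall>A\<in>carrier_mat m m. N A = 0 \<longleftrightarrow> A = 0\<^sub>m m m) \<and>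
     (\<forall>c. \<forall>A\<in>carrier_mat m m. N (c \<cdot>\<^sub>m A) = cmod c * N A) \<and>
     (\<forall>A\<in>carrier_mat m m. \<forall>B\<in>carrier_mat m m. N (A + B) \<le> N A + N B)"

definition consistent_matrix_norms :: "nat \<Rightarrow> (complex mat \<Rightarrow> real) set" where
  "consistent_matrix_norms m =
     {N. is_matrix_norm m N \<and>
         (\<forall>A\<in>carrier_mat m m. \<forall>B\<in>carrier_mat m m. N (A * B) \<le> N A * N B)}"

end

(* A consistent norm N of A bounds the modulus of every eigenvalue c of A: if V is the matrix all of
   whose columns are an eigenvector for c, then A V = c V, hence |c| N V <= N A * N V.
   Conversely, A is similar to an upper triangular T (Schur), and the maximum row sum norm with
   geometric weights 1, r, r^2, ... multiplies the entry of T at (i,j) by r^(j-i), so for small r it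
   shrinks everything off the diagonal; pulled back along the similarity, it is a consistent norm
   whose value at A exceeds the spectral radius by as little as one likes. *)
theory Submission
  imports Defs
begin

section \<open>Maximum row sum norms with positive weights\<close>

definition weighted_row_norm :: "nat \<Rightarrow> (nat \<Rightarrow> real) \<Rightarrow> complex mat \<Rightarrow> real" where
  "weighted_row_norm m w A = Max ((\<lambda>i. (\<Sum>j<m. cmod (A $$ (i, j)) * w j) / w i) ` {..<m})"

text \<open>For D the diagonal matrix of the weights, the norm is the maximum row sum of D^-1 A D,
  that is, the operator norm induced by the vector norm max |x_i| / w_i. Multiplying by
  \<open>w i > 0\<close> turns a bound on the maximum into one inequality per row without division,
  the form in which the later upper bounds are proved. \<open>m > 0\<close> keeps \<open>Max\<close>
  away from the empty set.\<close>

lemma weighted_row_norm_le_iff: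
  assumes "m > 0" "\<And>i. w i > 0"
  shows "weighted_row_norm m w A \<le> b \<longleftrightarrow> (\<forall>i<m. (\<Sum>j<m. cmod (A $$ (i, j)) * w j) \<le> b * w i)"
proof -
  have "(\<lambda>i. (\<Sum>j<m. cmod (A $$ (i, j)) * w j) / w i) ` {..<m} \<noteq> {}"
    using assms(1) by auto
  then show ?thesis
    unfolding weighted_row_norm_def by (subst Max_le_iff) (use assms(2) in \<open>auto simp: pos_divide_le_eq\<close>)
qed

lemma row_sum_le_weighted_row_norm:
  assumes "m > 0" "\<And>i. w i > 0" "i < m"
  shows "(\<Sum>j<m. cmod (A $$ (i, j)) * w j) \<le> weighted_row_norm m w A * w i"
  using weighted_row_norm_le_iff[where w = w and b = "weighted_row_norm m w A", OF assms(1,2)] assms(3) by blast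

lemma weighted_row_norm_nonneg:
  assumes "m > 0" "\<And>i. w i > 0"
  shows "0 \<le> weighted_row_norm m w A"
proof -
  have "0 \<le> (\<Sum>j<m. cmod (A $$ (0, j)) * w j)"
    using assms(2) by (intro sum_nonneg) (simp add: less_imp_le)
  also have "\<dots> \<le> weighted_row_norm m w A * w 0"
    using row_sum_le_weighted_row_norm[where w = w, OF assms assms(1)] .
  finally show ?thesis
    using assms(2)[of 0] by (simp add: zero_le_mult_iff)
qed

lemma weighted_row_norm_eq_0_iff:
  assumes "m > 0" "\<And>i. w i > 0" "A \<in> carrier_mat m m"
  shows "weighted_row_norm m w A = 0 \<longleftrightarrow> A = 0\<^sub>m m m"
proof
  assume eq: "weighted_row_norm m w A = 0"
  have "A $$ (i, j) = 0" if "i < m" "j < m" for i j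
  proof -
    have "cmod (A $$ (i, j)) * w j \<le> (\<Sum>j<m. cmod (A $$ (i, j)) * w j)"
      by (rule member_le_sum) (use that assms(2) in \<open>auto simp: less_imp_le\<close>)
    also have "\<dots> \<le> 0"
      using row_sum_le_weighted_row_norm[where w = w and A = A, OF assms(1,2) that(1)] eq by simp
    finally show ?thesis
      using assms(2)[of j] by (simp add: mult_le_0_iff)
  qed
  then show "A = 0\<^sub>m m m"
    using assms(3) by (intro eq_matI) auto
next
  assume "A = 0\<^sub>m m m"
  then have "weighted_row_norm m w A \<le> 0"
    by (simp add: weighted_row_norm_le_iff[where w = w, OF assms(1,2)])
  then show "weighted_row_norm m w A = 0"
    using weighted_row_norm_nonneg[where w = w and A = A, OF assms(1,2)] by linarith
qed

lemma weighted_row_norm_smult: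
  assumes "m > 0" "\<And>i. w i > 0" "A \<in> carrier_mat m m"
  shows "weighted_row_norm m w (c \<cdot>\<^sub>m A) = cmod c * weighted_row_norm m w A"
proof -
  have "(\<lambda>i. (\<Sum>j<m. cmod ((c \<cdot>\<^sub>m A) $$ (i, j)) * w j) / w i) ` {..<m}
    = (*) (cmod c) ` (\<lambda>i. (\<Sum>j<m. cmod (A $$ (i, j)) * w j) / w i) ` {..<m}"
    unfolding image_image using assms(3)
    by (intro image_cong) (auto simp: norm_mult sum_distrib_left mult.assoc intro!: sum.cong)
  \<comment> \<open>Scaling by a nonnegative real is monotone, so it can be moved past
    \<open>Max\<close>.\<close>
  moreover have "mono ((*) (cmod c))"
    by (intro monoI mult_left_mono) auto
  ultimately show ?thesis
    unfolding weighted_row_norm_def using assms(1) by (simp add: mono_Max_commute lessThan_empty_iff)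
qed

lemma weighted_row_norm_add:
  assumes "m > 0" "\<And>i. w i > 0" "A \<in> carrier_mat m m" "B \<in> carrier_mat m m"
  shows "weighted_row_norm m w (A + B) \<le> weighted_row_norm m w A + weighted_row_norm m w B"
  unfolding weighted_row_norm_le_iff[where w = w, OF assms(1,2)]
proof (intro allI impI)
  fix i assume i: "i < m"
  have "(\<Sum>j<m. cmod ((A + B) $$ (i, j)) * w j)
    \<le> (\<Sum>j<m. cmod (A $$ (i, j)) * w j + cmod (B $$ (i, j)) * w j)"
  proof (rule sum_mono)
    fix j assume "j \<in> {..<m}"
    then show "cmod ((A + B) $$ (i, j)) * w j \<le> cmod (A $$ (i, j)) * w j + cmod (B $$ (i, j)) * w j"
      using i assms(3,4) less_imp_le[OF assms(2)[of j]]
      by (simp add: distrib_right[symmetric] mult_right_mono norm_triangle_ineq)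
  qed
  also have "\<dots> \<le> (weighted_row_norm m w A + weighted_row_norm m w B) * w i"
    unfolding sum.distrib distrib_right
    by (intro add_mono row_sum_le_weighted_row_norm assms(1,2) i)
  finally show "(\<Sum>j<m. cmod ((A + B) $$ (i, j)) * w j)
    \<le> (weighted_row_norm m w A + weighted_row_norm m w B) * w i" .
qed

lemma weighted_row_norm_mult:
  assumes "m > 0" "\<And>i. w i > 0" "A \<in> carrier_mat m m" "B \<in> carrier_mat m m"
  shows "weighted_row_norm m w (A * B) \<le> weighted_row_norm m w A * weighted_row_norm m w B"
  unfolding weighted_row_norm_le_iff[where w = w, OF assms(1,2)]
proof (intro allI impI)
  fix i assume i: "i < m"
  let ?N = "weighted_row_norm m w"
  have "(\<Sum>j<m. cmod ((A * B) $$ (i, j)) * w j)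
    \<le> (\<Sum>j<m. \<Sum>k<m. cmod (A $$ (i, k)) * (cmod (B $$ (k, j)) * w j))"
  proof (rule sum_mono)
    fix j assume "j \<in> {..<m}"
    then have "(A * B) $$ (i, j) = (\<Sum>k<m. A $$ (i, k) * B $$ (k, j))"
      using i assms(3,4) by (simp add: scalar_prod_def atLeast0LessThan)
    then have "cmod ((A * B) $$ (i, j)) \<le> (\<Sum>k<m. cmod (A $$ (i, k)) * cmod (B $$ (k, j)))"
      by (simp add: norm_mult[symmetric] norm_sum)
    then show "cmod ((A * B) $$ (i, j)) * w j
      \<le> (\<Sum>k<m. cmod (A $$ (i, k)) * (cmod (B $$ (k, j)) * w j))"
      using mult_right_mono[OF _ less_imp_le[OF assms(2)[of j]]]
      by (fastforce simp: sum_distrib_right mult.assoc)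
  qed
  \<comment> \<open>After the exchange of sums, the inner sum is the weighted row sum of row k of B,
    at most \<open>?N B * w k\<close>. The \<open>w k\<close> left over is exactly the weight that
    the weighted sum of row i of A needs.\<close>
  also have "\<dots> = (\<Sum>k<m. cmod (A $$ (i, k)) * (\<Sum>j<m. cmod (B $$ (k, j)) * w j))"
    unfolding sum_distrib_left by (rule sum.swap)
  also have "\<dots> \<le> (\<Sum>k<m. cmod (A $$ (i, k)) * (?N B * w k))"
    by (intro sum_mono mult_left_mono row_sum_le_weighted_row_norm assms(1,2)) auto
  also have "\<dots> = (\<Sum>k<m. cmod (A $$ (i, k)) * w k) * ?N B"
    by (simp add: sum_distrib_left mult_ac)
  also have "\<dots> \<le> ?N A * w i * ?N B"
    by (intro mult_right_mono row_sum_le_weighted_row_norm weighted_row_norm_nonneg assms(1,2) i)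
  finally show "(\<Sum>j<m. cmod ((A * B) $$ (i, j)) * w j) \<le> ?N A * ?N B * w i"
    by (simp add: mult_ac)
qed

lemma weighted_row_norm_consistent:
  assumes "m > 0" "\<And>i. w i > 0"
  shows "weighted_row_norm m w \<in> consistent_matrix_norms m"
  unfolding consistent_matrix_norms_def is_matrix_norm_def
  using assms by (auto simp: weighted_row_norm_nonneg weighted_row_norm_eq_0_iff
      weighted_row_norm_smult weighted_row_norm_add weighted_row_norm_mult)

section \<open>Norms adapted to a triangular form\<close>

lemma consistent_matrix_norm_conjugate:
  assumes N: "N \<in> consistent_matrix_norms m"
    and P: "P \<in> carrier_mat m m" and Q: "Q \<in> carrier_mat m m"
    and PQ: "P * Q = 1\<^sub>m m"
  shows "(\<lambda>A. N (Q * A * P)) \<in> consistent_matrix_norms m"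
proof -
  have C: "Q * A * P \<in> carrier_mat m m" if "A \<in> carrier_mat m m" for A
    using that P Q by auto
  \<comment> \<open>Conjugation is multiplicative because the inner factor \<open>P * Q\<close>
    cancels.\<close>
  have mult: "Q * (A * B) * P = (Q * A * P) * (Q * B * P)"
    if A: "A \<in> carrier_mat m m" and B: "B \<in> carrier_mat m m" for A B
  proof -
    have "(Q * A * P) * (Q * B * P) = Q * A * ((P * Q) * B * P)"
      using A B P Q by (simp add: assoc_mult_mat[of _ m m _ m _ m])
    then show ?thesis
      using A B P Q PQ by (simp add: assoc_mult_mat[of _ m m _ m _ m])
  qed
  have add: "Q * (A + B) * P = Q * A * P + Q * B * P"
    if A: "A \<in> carrier_mat m m" and B: "B \<in> carrier_mat m m" for A B
    using A B P Q by (simp add: mult_add_distrib_mat[of _ m m _ m] add_mult_distrib_mat[of _ m m _ _ m])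
  have smult: "Q * (c \<cdot>\<^sub>m A) * P = c \<cdot>\<^sub>m (Q * A * P)" if A: "A \<in> carrier_mat m m" for c A
    using A P Q by (simp add: mult_smult_distrib[of _ m m _ m] mult_smult_assoc_mat[of _ m m _ m])
  \<comment> \<open>Definiteness carries over because A is recovered from \<open>Q * A * P\<close>
    by multiplying with P on the left and Q on the right.\<close>
  have zero: "Q * A * P = 0\<^sub>m m m \<longleftrightarrow> A = 0\<^sub>m m m" if A: "A \<in> carrier_mat m m" for A
  proof
    assume 0: "Q * A * P = 0\<^sub>m m m"
    have "A = (P * Q) * A * (P * Q)"
      using A PQ by simp
    also have "\<dots> = P * (Q * A * P) * Q"
      using A P Q by (simp add: assoc_mult_mat[of _ m m _ m _ m])
    finally show "A = 0\<^sub>m m m"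
      using 0 P Q by simp
  qed (use P Q in simp)
  show ?thesis
    using N unfolding consistent_matrix_norms_def is_matrix_norm_def
    by (simp add: C mult add smult zero)
qed

lemma diag_upper_triangular_similar_le_spectral_radius:
  assumes A: "A \<in> carrier_mat m m" and sim: "similar_mat A T" and T: "T \<in> carrier_mat m m"
    and ut: "upper_triangular T" and i: "i < m"
  shows "cmod (T $$ (i, i)) \<le> spectral_radius A"
proof -
  have "T $$ (i, i) \<in> set (diag_mat T)"
    using T i by (auto simp: diag_mat_def)
  \<comment> \<open>Similar matrices share their characteristic polynomial, and that of a triangular
    matrix splits into linear factors with the diagonal entries as roots. So every diagonal entry of
    T is an eigenvalue of A.\<close>
  then have "poly (char_poly A) (T $$ (i, i)) = 0"
    unfolding char_poly_similar[OF sim] char_poly_upper_triangular[OF T ut]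
    by (rule linear_poly_root)
  then have "cmod (T $$ (i, i)) \<in> cmod ` spectrum A"
    unfolding spectrum_root_char_poly[OF A] by blast
  then show ?thesis
    using spectral_radius_mem_max(2)[OF A] i by simp
qed

lemma weighted_row_norm_upper_triangular_le:
  assumes m: "m > 0" and T: "T \<in> carrier_mat m m" and ut: "upper_triangular T"
    and diag: "\<And>i. i < m \<Longrightarrow> cmod (T $$ (i, i)) \<le> b"
    and r: "0 < r" "r \<le> 1"
  shows "weighted_row_norm m (\<lambda>i. r ^ i) T \<le> b + r * (\<Sum>i<m. \<Sum>j<m. cmod (T $$ (i, j)))"
proof -
  have w: "\<And>i. r ^ i > 0" using r by simp
  show ?thesis
    unfolding weighted_row_norm_le_iff[OF m w]
  proof (intro allI impI)
    fix i assume i: "i < m"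
    \<comment> \<open>Every entry of the row is charged \<open>r * cmod (T $$ (i, j))\<close>, and
      the diagonal one b in addition. On and below the diagonal this is generous, but it gives a
      bound uniform in j that sums at once.\<close>
    have "(\<Sum>j<m. cmod (T $$ (i, j)) * r ^ j)
      \<le> (\<Sum>j<m. (if j = i then b * r ^ i else 0) + r * cmod (T $$ (i, j)) * r ^ i)"
    proof (rule sum_mono)
      fix j assume "j \<in> {..<m}"
      consider "j < i" | "j = i" | "i < j" by linarith
      then show "cmod (T $$ (i, j)) * r ^ j
        \<le> (if j = i then b * r ^ i else 0) + r * cmod (T $$ (i, j)) * r ^ i"
      proof cases
        case 1
        then show ?thesis using T i upper_triangularD[OF ut, of j i] by simp
      next
        case 2
        have "cmod (T $$ (i, i)) * r ^ i \<le> b * r ^ i"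
          using diag[OF i] r by (intro mult_right_mono) auto
        moreover have "0 \<le> r * cmod (T $$ (i, i)) * r ^ i" using r by simp
        ultimately show ?thesis using 2 by simp
      next
        case 3
        \<comment> \<open>Above the diagonal j is at least i + 1, so with r at most 1 at least one
          factor r is gained over the weight of row i.\<close>
        have "r ^ j \<le> r ^ Suc i"
          using 3 r by (intro power_decreasing) auto
        then have "cmod (T $$ (i, j)) * r ^ j \<le> cmod (T $$ (i, j)) * r ^ Suc i"
          by (rule mult_left_mono) simp
        then show ?thesis using 3 by (simp add: mult_ac)
      qed
    qed
    also have "\<dots> = (b + r * (\<Sum>j<m. cmod (T $$ (i, j)))) * r ^ i"
      using i by (simp add: sum.distrib sum_distrib_left sum_distrib_right distrib_right)
    also have "\<dots> \<le> (b + r * (\<Sum>i<m. \<Sum>j<m. cmod (T $$ (i, j)))) * r ^ i"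
    proof -
      have "(\<Sum>j<m. cmod (T $$ (i, j))) \<le> (\<Sum>i<m. \<Sum>j<m. cmod (T $$ (i, j)))"
        by (rule member_le_sum[where f = "\<lambda>i. \<Sum>j<m. cmod (T $$ (i, j))"])
          (use i in \<open>auto intro: sum_nonneg\<close>)
      then show ?thesis
        using r by (intro mult_right_mono add_left_mono mult_left_mono) auto
    qed
    finally show "(\<Sum>j<m. cmod (T $$ (i, j)) * r ^ j)
      \<le> (b + r * (\<Sum>i<m. \<Sum>j<m. cmod (T $$ (i, j)))) * r ^ i" .
  qed
qed

lemma exists_consistent_norm_near_spectral_radius:
  assumes A: "A \<in> carrier_mat m m" and m: "m > 0" and e: "e > 0"
  shows "\<exists>N\<in>consistent_matrix_norms m. N A \<le> spectral_radius A + e"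
proof -
  obtain as where "char_poly A = (\<Prod>a\<leftarrow>as. [:- a, 1:])"
    using char_poly_factorized[OF A] by blast
  then obtain T where T: "T \<in> carrier_mat m m" and ut: "upper_triangular T" and sim: "similar_mat A T"
    using schur_decomposition_exists[OF A] by blast
  then obtain P Q where wit: "similar_mat_wit A T P Q"
    unfolding similar_mat_def by blast
  note PQ = similar_mat_witD2[OF A wit]
  \<comment> \<open>The witness says \<open>A = P * T * Q\<close>; its symmetric form gives T
    back.\<close>
  have QAP: "Q * A * P = T"
    using similar_mat_witD2(3)[OF T similar_mat_wit_sym[OF wit]] by simp
  define S where "S = (\<Sum>i<m. \<Sum>j<m. cmod (T $$ (i, j)))"
  \<comment> \<open>The excess over the spectral radius will be at most \<open>r * S\<close>, and
    this r keeps it below e. The denominator S + 1 stays positive even if T is zero; the minimum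
    with 1 ensures the decreasing weights that the triangular bound requires.\<close>
  define r where "r = min 1 (e / (S + 1))"
  have S: "S \<ge> 0" unfolding S_def by (intro sum_nonneg) auto
  have r: "0 < r" "r \<le> 1" using S e by (auto simp: r_def)
  have "r * S \<le> e / (S + 1) * (S + 1)"
    using S r e by (intro mult_mono) (auto simp: r_def)
  then have "r * S \<le> e" using S by simp
  moreover have "weighted_row_norm m (\<lambda>i. r ^ i) T \<le> spectral_radius A + r * S"
    unfolding S_def
    by (rule weighted_row_norm_upper_triangular_le[OF m T ut _ r])
      (rule diag_upper_triangular_similar_le_spectral_radius[OF A sim T ut])
  ultimately have "weighted_row_norm m (\<lambda>i. r ^ i) (Q * A * P) \<le> spectral_radius A + e"
    unfolding QAP by linarith
  moreover have "(\<lambda>A. weighted_row_norm m (\<lambda>i. r ^ i) (Q * A * P)) \<in> consistent_matrix_norms m"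
    by (rule consistent_matrix_norm_conjugate[OF weighted_row_norm_consistent[OF m]])
      (use r PQ in auto)
  ultimately show ?thesis
    by (intro bexI[where x = "\<lambda>A. weighted_row_norm m (\<lambda>i. r ^ i) (Q * A * P)"])
qed

section \<open>The eigenvalue bound and the infimum\<close>

lemma spectral_radius_le_consistent_norm:
  assumes A: "A \<in> carrier_mat m m" and m: "m > 0" and N: "N \<in> consistent_matrix_norms m"
  shows "spectral_radius A \<le> N A"
proof -
  obtain c where c: "spectral_radius A = cmod c" "c \<in> spectrum A"
    using spectral_radius_mem_max(1)[OF A m] by blast
  then obtain v where v: "v \<in> carrier_vec m" "v \<noteq> 0\<^sub>v m" and Av: "A *\<^sub>v v = c \<cdot>\<^sub>v v"
    using A unfolding spectrum_def eigenvalue_def eigenvector_def by auto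
  \<comment> \<open>N measures m by m matrices and not vectors, so the eigenvector is repeated to
    fill a square matrix.\<close>
  define V where "V = mat m m (\<lambda>(i, j). v $ i)"
  have V: "V \<in> carrier_mat m m" by (simp add: V_def)
  have col: "col V j = v" if "j < m" for j
    using that v(1) by (intro eq_vecI) (auto simp: V_def)
  have AV: "A * V = c \<cdot>\<^sub>m V"
  proof (rule eq_matI)
    fix i j assume "i < dim_row (c \<cdot>\<^sub>m V)" "j < dim_col (c \<cdot>\<^sub>m V)"
    then have ij: "i < m" "j < m" using V by auto
    then have "(A * V) $$ (i, j) = (A *\<^sub>v v) $ i"
      using A V col by simp
    also have "\<dots> = (c \<cdot>\<^sub>m V) $$ (i, j)"
      using ij v(1) by (simp add: Av V_def)
    finally show "(A * V) $$ (i, j) = (c \<cdot>\<^sub>m V) $$ (i, j)" .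
  qed (use A V in auto)
  have "V \<noteq> 0\<^sub>m m m"
    using col[OF m] v(2) m by (metis col_zero)
  \<comment> \<open>Strict positivity is what allows \<open>N V\<close> to be cancelled at the
    end.\<close>
  then have NV: "N V > 0"
    using N V unfolding consistent_matrix_norms_def is_matrix_norm_def by (auto simp: less_le)
  have "cmod c * N V = N (A * V)"
    using N V unfolding AV consistent_matrix_norms_def is_matrix_norm_def by simp
  also have "\<dots> \<le> N A * N V"
    using N A V unfolding consistent_matrix_norms_def by simp
  finally show ?thesis
    using NV c(1) by simp
qed

lemma spectral_radius_eq_Inf_consistent_norms:
  assumes A: "A \<in> carrier_mat m m" and m: "m > 0"
  shows "spectral_radius A = (INF N \<in> consistent_matrix_norms m. N A)"
proof (rule antisym)
  \<comment> \<open>Over the reals an infimum obeys its laws only for a nonempty set that is bounded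
    below: nonemptiness serves this inequality, the bound \<open>bdd\<close> the other.\<close>
  have "consistent_matrix_norms m \<noteq> {}"
    using exists_consistent_norm_near_spectral_radius[OF A m, of 1] by auto
  then show "spectral_radius A \<le> (INF N \<in> consistent_matrix_norms m. N A)"
    by (intro cINF_greatest spectral_radius_le_consistent_norm[OF A m])
  have bdd: "bdd_below ((\<lambda>N. N A) ` consistent_matrix_norms m)"
    using spectral_radius_le_consistent_norm[OF A m] by (intro bdd_belowI2)
  show "(INF N \<in> consistent_matrix_norms m. N A) \<le> spectral_radius A"
  \<comment> \<open>The infimum need not be attained: for a nonzero nilpotent matrix the spectral
    radius is 0, but every norm is positive. Hence the argument with an arbitrary e.\<close>
  proof (rule field_le_epsilon)
    fix e :: real assume "e > 0"
    then obtain N where "N \<in> consistent_matrix_norms m" "N A \<le> spectral_radius A + e"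
      using exists_consistent_norm_near_spectral_radius[OF A m] by blast
    then show "(INF N \<in> consistent_matrix_norms m. N A) \<le> spectral_radius A + e"
      using cINF_lower2[OF bdd] by blast
  qed
qed

section \<open>Application to the conjugate Kronecker sum\<close>

lemma conj_kronecker_sum_carrier:
  assumes "\<And>i. i \<in> {1..d} \<Longrightarrow> X i \<in> carrier_mat n n"
  shows "conj_kronecker_sum n d X \<in> carrier_mat (n\<^sup>2) (n\<^sup>2)"
proof -
  \<comment> \<open>The sum is a \<open>finsum\<close> in this group, so closure reduces to the size
    of each summand; for d = 0 it is the zero matrix of size \<open>n\<^sup>2\<close>.\<close>
  interpret abelian_group "module_mat TYPE(complex) (n\<^sup>2) (n\<^sup>2)"
    by (rule abelian_group_mat)
  have "mat_conjugate (X i) \<otimes>\<^sub>K X i \<in> carrier_mat (n\<^sup>2) (n\<^sup>2)" if "i \<in> {1..d}" for i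
    using assms[OF that] by (simp add: kronecker_def mat_conjugate_def power2_eq_square)
  then show ?thesis
    unfolding conj_kronecker_sum_def
    using finsum_closed[of "\<lambda>i. mat_conjugate (X i) \<otimes>\<^sub>K X i" "{1..d}"]
    by (auto simp: module_mat_simps)
qed

theorem theorem1p8:
  fixes n d :: nat and X :: "nat \<Rightarrow> complex mat"
  assumes "n \<ge> 1"
    and "\<And>i. i \<in> {1..d} \<Longrightarrow> X i \<in> carrier_mat n n"
  shows "outer_spectral_radius n d X =
    sqrt (INF N \<in> consistent_matrix_norms (n\<^sup>2). N (conj_kronecker_sum n d X))"
  unfolding outer_spectral_radius_def
  \<comment> \<open>The identity for a single matrix is applied at size \<open>n\<^sup>2\<close>,
    which is positive because n is at least 1.\<close>
  using spectral_radius_eq_Inf_consistent_norms[OF conj_kronecker_sum_carrier[OF assms(2)]] assms(1)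
  by simp

end
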